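(* Let $V$ be a finite set and let $S$ be a game on $V$ with at least two powerful voters. Then $S$ is the median $m(S_1,S_2,S_3)$ of three games $S_1,S_2,S_3$ on $V$, each having strictly more dummies than $S$. Moreover, if $S$ is strong (respectively simple, respectively strong and simple), then $S_1,S_2,S_3$ can be chosen to be strong (respectively simple, respectively strong and simple) as well.
   Context: A game on a finite set $V$ is a family $S$ of subsets of $V$ (winning coalitions) that is upward closed. $S$ is strong if for every $A\subseteq V$, $A\in S$ or $V\setminus A\in S$; simple if no $A$ has both $A\in S$ and $V\setminus A\in S$. A voter $v\in V$ is a dummy of $S$ if $v$ belongs to no minimal winning coalition of $S$; otherwise $v$ is powerful. The median of three games $S,T,U$ on $V$ is $m(S,T,U)=(S\cap T)\cup(S\cap U)\cup(T\cap U)$. *)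

theory Defs
  imports Main
begin

definition game_on :: "'a set \<Rightarrow> 'a set set \<Rightarrow> bool" where
  "game_on V S \<longleftrightarrow> S \<subseteq> Pow V \<and> (\<forall>A B. A \<in> S \<longrightarrow> A \<subseteq> B \<longrightarrow> B \<subseteq> V \<longrightarrow> B \<in> S)"

definition strong_game :: "'a set \<Rightarrow> 'a set set \<Rightarrow> bool" where
  "strong_game V S \<longleftrightarrow> (\<forall>A. A \<subseteq> V \<longrightarrow> A \<in> S \<or> V - A \<in> S)"

definition simple_game :: "'a set \<Rightarrow> 'a set set \<Rightarrow> bool" where
  "simple_game V S \<longleftrightarrow> \<not> (\<exists>A. A \<subseteq> V \<and> A \<in> S \<and> V - A \<in> S)"

definition minimal_winning :: "'a set set \<Rightarrow> 'a set \<Rightarrow> bool" where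
  "minimal_winning S A \<longleftrightarrow> A \<in> S \<and> (\<forall>B. B \<subset> A \<longrightarrow> B \<notin> S)"

definition dummies :: "'a set \<Rightarrow> 'a set set \<Rightarrow> 'a set" where
  "dummies V S = {v \<in> V. \<not> (\<exists>A. minimal_winning S A \<and> v \<in> A)}"

definition powerful_voters :: "'a set \<Rightarrow> 'a set set \<Rightarrow> 'a set" where
  "powerful_voters V S = V - dummies V S"

definition median_game :: "'a set set \<Rightarrow> 'a set set \<Rightarrow> 'a set set \<Rightarrow> 'a set set" where
  "median_game S T U = (S \<inter> T) \<union> (S \<inter> U) \<union> (T \<inter> U)"

text \<open>The number of dummies is compared by cardinality; this is meaningful because
  the set of voters is assumed to be finite wherever this predicate is used.\<close>

definition median_decomposition ::
    "'a set \<Rightarrow> 'a set set \<Rightarrow> 'a set set \<Rightarrow> 'a set set \<Rightarrow> 'a set set \<Rightarrow> bool" where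
  "median_decomposition V S S1 S2 S3 \<longleftrightarrow>
     S = median_game S1 S2 S3 \<and>
     (\<forall>T \<in> {S1, S2, S3}. game_on V T \<and> card (dummies V S) < card (dummies V T))"

end

theory Submission
  imports Defs
begin

text \<open>Let \<open>S[x:=y]\<close> be the game in which \<open>x\<close> votes like \<open>y\<close>. If there are three powerful voters
  \<open>x\<close>, \<open>y\<close>, \<open>z\<close>, then \<open>S\<close> is the median of \<open>S[x:=y]\<close>, \<open>S[y:=z]\<close> and \<open>S[z:=x]\<close>: in every vote
  two of the three voters agree, so one of the games gives the outcome of \<open>S\<close>, and if the third
  voter disagrees, then the other two games alter the vote in opposite directions. If \<open>x\<close> and \<open>y\<close>
  are the only powerful voters, then \<open>S\<close> is their conjunction or disjunction, which is the median
  of \<open>S[x:=y]\<close>, \<open>S[y:=x]\<close> and a constant game.\<close>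

section \<open>Dummies and minimal winning coalitions\<close>

lemma game_on_mono:
  assumes "game_on V S" "A \<in> S" "A \<subseteq> B" "B \<subseteq> V"
  shows "B \<in> S"
  using assms unfolding game_on_def by blast

lemma minimal_winning_subset:
  assumes "finite A" "A \<in> S"
  obtains B where "minimal_winning S B" "B \<subseteq> A"
proof -
  from assms have "\<exists>B. minimal_winning S B \<and> B \<subseteq> A"
  proof (induction A rule: finite_psubset_induct)
    case (psubset A)
    show ?case
    proof (cases "minimal_winning S A")
      case False
      then obtain B where "B \<subset> A" "B \<in> S"
        using psubset.prems unfolding minimal_winning_def by blast
      then show ?thesis
        using psubset.IH[of B] by blast
    qed blast
  qed
  then show ?thesis
    using that by blast
qed

text \<open>A winning coalition contains a minimal one, which avoids the dummy \<open>v\<close> and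
  hence survives its removal. This criterion speaks of all winning coalitions, so the dummies of a
  modified game can be found without determining its minimal coalitions.\<close>

lemma dummies_iff:
  assumes "finite V" "game_on V S"
  shows "v \<in> dummies V S \<longleftrightarrow> v \<in> V \<and> (\<forall>A \<in> S. A - {v} \<in> S)"
proof
  assume v: "v \<in> dummies V S"
  have "A - {v} \<in> S" if win: "A \<in> S" for A
  proof -
    have A: "A \<subseteq> V"
      using win assms(2) unfolding game_on_def by blast
    then obtain B where B: "minimal_winning S B" "B \<subseteq> A"
      using minimal_winning_subset win assms(1) finite_subset by metis
    then have "B \<in> S" "B \<subseteq> A - {v}"
      using v unfolding dummies_def minimal_winning_def by blast+
    then show ?thesis
      using game_on_mono[OF assms(2)] A by blast
  qed
  then show "v \<in> V \<and> (\<forall>A \<in> S. A - {v} \<in> S)"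
    using v unfolding dummies_def by blast
next
  assume "v \<in> V \<and> (\<forall>A \<in> S. A - {v} \<in> S)"
  then show "v \<in> dummies V S"
    unfolding dummies_def minimal_winning_def by blast
qed

lemma minimal_winning_subset_powerful_voters:
  assumes "game_on V S" "minimal_winning S A"
  shows "A \<subseteq> powerful_voters V S"
proof -
  have "A \<subseteq> V"
    using assms unfolding game_on_def minimal_winning_def by blast
  then show ?thesis
    using assms(2) unfolding powerful_voters_def dummies_def by blast
qed

text \<open>A minimal winning coalition inside \<open>A\<close> consists of powerful voters only, so
  it already lies in the intersection.\<close>

lemma winning_iff_Int_powerful_voters:
  assumes "finite V" "game_on V S" "A \<subseteq> V"
  shows "A \<in> S \<longleftrightarrow> A \<inter> powerful_voters V S \<in> S"
proof
  assume "A \<in> S"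
  then obtain B where B: "minimal_winning S B" "B \<subseteq> A"
    using minimal_winning_subset assms(1,3) finite_subset by metis
  then have "B \<in> S" "B \<subseteq> A \<inter> powerful_voters V S"
    using minimal_winning_subset_powerful_voters[OF assms(2)] unfolding minimal_winning_def by blast+
  then show "A \<inter> powerful_voters V S \<in> S"
    using game_on_mono[OF assms(2)] assms(3) by blast
next
  assume "A \<inter> powerful_voters V S \<in> S"
  then show "A \<in> S"
    using game_on_mono[OF assms(2)] assms(3) by blast
qed

section \<open>Games in which one voter copies another\<close>

definition copy_vote :: "'a \<Rightarrow> 'a \<Rightarrow> 'a set \<Rightarrow> 'a set" where
  "copy_vote x y A = (if y \<in> A then insert x A else A - {x})"

text \<open>This is \<open>S[x:=y]\<close>, encoded as a preimage of \<open>S\<close>, so that its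
  properties follow from those of \<open>copy_vote\<close>.\<close>

definition copy_game :: "'a set \<Rightarrow> 'a \<Rightarrow> 'a \<Rightarrow> 'a set set \<Rightarrow> 'a set set" where
  "copy_game V x y S = {A. A \<subseteq> V \<and> copy_vote x y A \<in> S}"

lemma copy_vote_mono: "A \<subseteq> B \<Longrightarrow> copy_vote x y A \<subseteq> copy_vote x y B"
  unfolding copy_vote_def by auto

lemma copy_vote_subset: "x \<in> V \<Longrightarrow> A \<subseteq> V \<Longrightarrow> copy_vote x y A \<subseteq> V"
  unfolding copy_vote_def by auto

text \<open>Reversing all votes also reverses the copied one. Complementary pairs thus go to
  complementary pairs, which carries strength and simplicity over to the copy game.\<close>

lemma copy_vote_Diff: "x \<in> V \<Longrightarrow> y \<in> V \<Longrightarrow> copy_vote x y (V - A) = V - copy_vote x y A"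
  unfolding copy_vote_def by auto

lemma copy_vote_remove: "v \<noteq> x \<Longrightarrow> v \<noteq> y \<Longrightarrow> copy_vote x y (A - {v}) = copy_vote x y A - {v}"
  unfolding copy_vote_def by auto

lemma copy_vote_remove_copy: "x \<noteq> y \<Longrightarrow> copy_vote x y (A - {x}) = copy_vote x y A"
  unfolding copy_vote_def by auto

lemma game_on_copy_game:
  assumes "game_on V S" "x \<in> V"
  shows "game_on V (copy_game V x y S)"
proof -
  have "copy_vote x y B \<in> S" if "copy_vote x y A \<in> S" "A \<subseteq> B" "B \<subseteq> V" for A B
    using game_on_mono[OF assms(1) that(1)] copy_vote_mono copy_vote_subset[OF assms(2)] that(2,3)
    by metis
  then show ?thesis
    unfolding game_on_def copy_game_def by blast
qed

lemma strong_copy_game: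
  assumes "strong_game V S" "x \<in> V" "y \<in> V"
  shows "strong_game V (copy_game V x y S)"
  using assms copy_vote_subset[OF assms(2)]
  unfolding strong_game_def copy_game_def by (simp add: copy_vote_Diff)

lemma simple_copy_game:
  assumes "simple_game V S" "x \<in> V" "y \<in> V"
  shows "simple_game V (copy_game V x y S)"
  using assms copy_vote_subset[OF assms(2)]
  unfolding simple_game_def copy_game_def by (auto simp: copy_vote_Diff)

text \<open>The voter \<open>y\<close> must be powerful: in \<open>S[x:=y]\<close> it inherits the influence of \<open>x\<close>.\<close>

lemma card_dummies_copy_game:
  assumes "finite V" "game_on V S" "x \<in> powerful_voters V S" "y \<in> powerful_voters V S" "x \<noteq> y"
  shows "card (dummies V S) < card (dummies V (copy_game V x y S))"
proof (rule psubset_card_mono)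
  have "dummies V T \<subseteq> V" for T :: "'a set set"
    unfolding dummies_def by blast
  then show "finite (dummies V (copy_game V x y S))"
    using assms(1) finite_subset by blast
  have xy: "x \<in> V" "x \<notin> dummies V S" "y \<notin> dummies V S"
    using assms unfolding powerful_voters_def by auto
  note iff = dummies_iff[OF assms(1) game_on_copy_game[OF assms(2) xy(1)]]
  have "x \<in> dummies V (copy_game V x y S)"
    using xy assms(5) unfolding iff by (auto simp: copy_game_def copy_vote_remove_copy)
  moreover have "v \<in> dummies V (copy_game V x y S)" if "v \<in> dummies V S" for v
  proof -
    \<comment> \<open>Both \<open>x\<close> and \<open>y\<close> are powerful, so a dummy differs
      from them and its removal commutes with the copying.\<close>
    have "v \<noteq> x" "v \<noteq> y"
      using that xy by auto
    then show ?thesis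
      using that unfolding iff dummies_iff[OF assms(1,2)]
      by (auto simp: copy_game_def copy_vote_remove)
  qed
  ultimately show "dummies V S \<subset> dummies V (copy_game V x y S)"
    using xy by blast
qed

section \<open>Three powerful voters\<close>

lemma median_game_copy_game:
  assumes "game_on V S" "x \<in> V" "y \<in> V" "z \<in> V" "x \<noteq> y" "y \<noteq> z" "z \<noteq> x"
  shows "S = median_game (copy_game V x y S) (copy_game V y z S) (copy_game V z x S)"
proof -
  \<comment> \<open>In a chain of three coalitions the outcomes are monotone, so their majority is
    the outcome of the middle one.\<close>
  have squeeze: "A \<in> S \<longleftrightarrow> (A \<in> S \<and> P \<in> S) \<or> (A \<in> S \<and> Q \<in> S) \<or> (P \<in> S \<and> Q \<in> S)"
    if "A \<subseteq> V" "P \<subseteq> V" "Q \<subseteq> V" "P \<subseteq> A \<and> A \<subseteq> Q \<or> Q \<subseteq> A \<and> A \<subseteq> P" for A P Q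
    using game_on_mono[OF assms(1)] that by blast
  have "A \<in> S \<longleftrightarrow> (copy_vote x y A \<in> S \<and> copy_vote y z A \<in> S) \<or>
      (copy_vote x y A \<in> S \<and> copy_vote z x A \<in> S) \<or> (copy_vote y z A \<in> S \<and> copy_vote z x A \<in> S)"
    if A: "A \<subseteq> V" for A
  proof -
    let ?X = "copy_vote x y A" and ?Y = "copy_vote y z A" and ?Z = "copy_vote z x A"
    note sub = copy_vote_subset[OF assms(2) A, of y] copy_vote_subset[OF assms(3) A, of z]
      copy_vote_subset[OF assms(4) A, of x]
    consider "x \<in> A \<longleftrightarrow> y \<in> A" | "y \<in> A \<longleftrightarrow> z \<in> A" | "z \<in> A \<longleftrightarrow> x \<in> A"
      by blast
    then show ?thesis
    proof cases
      case 1
      \<comment> \<open>The cyclic choice of the games matters here: the remaining voter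
        \<open>z\<close> is copied in one of the other two games and copies in the other, so a
        dissenting \<open>z\<close> moves them to opposite sides of \<open>A\<close>.\<close>
      then have "?X = A" "?Y \<subseteq> A \<and> A \<subseteq> ?Z \<or> ?Z \<subseteq> A \<and> A \<subseteq> ?Y"
        unfolding copy_vote_def by auto
      then show ?thesis
        using squeeze[OF A, of ?Y ?Z] sub by metis
    next
      case 2
      then have "?Y = A" "?X \<subseteq> A \<and> A \<subseteq> ?Z \<or> ?Z \<subseteq> A \<and> A \<subseteq> ?X"
        unfolding copy_vote_def by auto
      then show ?thesis
        using squeeze[OF A, of ?X ?Z] sub by metis
    next
      case 3
      then have "?Z = A" "?X \<subseteq> A \<and> A \<subseteq> ?Y \<or> ?Y \<subseteq> A \<and> A \<subseteq> ?X"
        unfolding copy_vote_def by auto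
      then show ?thesis
        using squeeze[OF A, of ?X ?Y] sub by metis
    qed
  qed
  moreover have "S \<subseteq> Pow V"
    using assms(1) unfolding game_on_def by blast
  ultimately show ?thesis
    unfolding median_game_def copy_game_def by blast
qed

lemma median_decomposition_of_three_powerful_voters:
  assumes "finite V" "game_on V S" "{x, y, z} \<subseteq> powerful_voters V S" "x \<noteq> y" "y \<noteq> z" "z \<noteq> x"
  shows "median_decomposition V S (copy_game V x y S) (copy_game V y z S) (copy_game V z x S)"
proof -
  have "{x, y, z} \<subseteq> V"
    using assms(3) unfolding powerful_voters_def by blast
  then show ?thesis
    unfolding median_decomposition_def
    using assms median_game_copy_game[OF assms(2)] card_dummies_copy_game[OF assms(1,2)]
      game_on_copy_game[OF assms(2)]
    by simp
qed

section \<open>Exactly two powerful voters\<close>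

text \<open>The only minimal winning coalition of \<open>Pow V\<close> is empty, and the game
  \<open>{}\<close> has none.\<close>

lemma dummies_constant: "dummies V (if b then Pow V else {}) = V"
  unfolding dummies_def minimal_winning_def by auto

lemma game_on_constant: "game_on V (if b then Pow V else {})"
  unfolding game_on_def by auto

text \<open>Some minimal winning coalition contains \<open>y\<close> and lies in
  \<open>{x, y}\<close>; as \<open>{x}\<close> wins, minimality leaves only
  \<open>{y}\<close>.\<close>

lemma singleton_winning_swap:
  assumes "game_on V S" "powerful_voters V S = {x, y}" "{x} \<in> S"
  shows "{y} \<in> S"
proof -
  have "y \<in> powerful_voters V S"
    using assms(2) by blast
  then obtain A where A: "minimal_winning S A" "y \<in> A"
    unfolding powerful_voters_def dummies_def by blast
  then have "A \<subseteq> {x, y}"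
    using minimal_winning_subset_powerful_voters[OF assms(1)] assms(2) by blast
  moreover have "\<not> {x} \<subset> A"
    using A(1) assms(3) unfolding minimal_winning_def by blast
  ultimately have "A = {y}"
    using A(2) by blast
  then show ?thesis
    using A(1) unfolding minimal_winning_def by blast
qed

text \<open>The median with \<open>Pow V\<close> is the union of the other two games, and the median
  with \<open>{}\<close> is their intersection. Whether \<open>{x}\<close> wins tells the
  disjunction of \<open>x\<close> and \<open>y\<close> from their conjunction.\<close>

lemma median_game_copy_game_constant:
  assumes "finite V" "game_on V S" "powerful_voters V S = {x, y}" "x \<noteq> y"
  shows "S = median_game (copy_game V x y S) (copy_game V y x S) (if {x} \<in> S then Pow V else {})"
proof -
  have xy: "x \<in> V" "y \<in> V"
    using assms(3) unfolding powerful_voters_def by auto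
  have swap: "{x} \<in> S \<longleftrightarrow> {y} \<in> S"
    using singleton_winning_swap[OF assms(2)] assms(3) by (metis insert_commute)
  have empty: "{x} \<in> S" if "{} \<in> S"
    using game_on_mono[OF assms(2) that] xy by blast
  have "A \<in> S \<longleftrightarrow> (if {x} \<in> S then copy_vote x y A \<in> S \<or> copy_vote y x A \<in> S
      else copy_vote x y A \<in> S \<and> copy_vote y x A \<in> S)" if A: "A \<subseteq> V" for A
  proof (cases "x \<in> A \<longleftrightarrow> y \<in> A")
    case True
    then have "copy_vote x y A = A" "copy_vote y x A = A"
      unfolding copy_vote_def by auto
    then show ?thesis
      by simp
  next
    case False
    have iff: "B \<in> S \<longleftrightarrow> B \<inter> {x, y} \<in> S" if "B \<subseteq> V" for B
      using winning_iff_Int_powerful_voters[OF assms(1,2) that] assms(3) by simp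
    have "A \<inter> {x, y} = {x} \<or> A \<inter> {x, y} = {y}"
      using False by blast
    then have "A \<in> S \<longleftrightarrow> {x} \<in> S"
      using iff[OF A] swap by metis
    \<comment> \<open>When \<open>x\<close> and \<open>y\<close> disagree, one copy makes both vote
      against and the other makes both vote in favour. The former loses if \<open>{x}\<close> loses,
      because then \<open>{}\<close> loses too; the latter contains \<open>A\<close> and so wins if
      \<open>A\<close> does.\<close>
    moreover have "copy_vote x y A \<inter> {x, y} = {} \<or> copy_vote y x A \<inter> {x, y} = {}"
      using False unfolding copy_vote_def by auto
    then have "copy_vote x y A \<notin> S \<or> copy_vote y x A \<notin> S" if "{x} \<notin> S"
      using that empty iff copy_vote_subset[OF xy(1) A] copy_vote_subset[OF xy(2) A] by metis
    moreover have "A \<subseteq> copy_vote x y A \<or> A \<subseteq> copy_vote y x A"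
      using False unfolding copy_vote_def by auto
    then have "copy_vote x y A \<in> S \<or> copy_vote y x A \<in> S" if "A \<in> S"
      using game_on_mono[OF assms(2) that] copy_vote_subset[OF xy(1) A]
        copy_vote_subset[OF xy(2) A] by metis
    ultimately show ?thesis
      by auto
  qed
  moreover have "S \<subseteq> Pow V"
    using assms(2) unfolding game_on_def by blast
  ultimately show ?thesis
    unfolding median_game_def copy_game_def by (cases "{x} \<in> S"; simp; blast)
qed

text \<open>If \<open>{x}\<close> lost, its complement would win, and \<open>y\<close> is the only
  powerful voter there; so \<open>{y}\<close> and hence \<open>{x}\<close> would win. The constant
  game used is therefore \<open>Pow V\<close>, which is strong.\<close>

lemma strong_game_constant:
  assumes "finite V" "game_on V S" "powerful_voters V S = {x, y}" "x \<noteq> y" "strong_game V S"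
  shows "{x} \<in> S"
proof (rule ccontr)
  assume *: "{x} \<notin> S"
  have "{x, y} \<subseteq> V"
    using assms(3) unfolding powerful_voters_def by blast
  then have "V - {x} \<in> S" "(V - {x}) \<inter> {x, y} = {y}"
    using * assms(4,5) unfolding strong_game_def by auto
  then have "{y} \<in> S"
    using winning_iff_Int_powerful_voters[OF assms(1,2), of "V - {x}"] assms(3) by auto
  then show False
    using * singleton_winning_swap[OF assms(2), of y x] assms(3) by (simp add: insert_commute)
qed

text \<open>If \<open>{x}\<close> won, so would \<open>{y}\<close> and thus the complement of
  \<open>{x}\<close>. The constant game used is therefore \<open>{}\<close>, which is
  simple.\<close>

lemma simple_game_constant:
  assumes "game_on V S" "powerful_voters V S = {x, y}" "x \<noteq> y" "simple_game V S"
  shows "{x} \<notin> S"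
proof
  assume *: "{x} \<in> S"
  have xy: "{x, y} \<subseteq> V"
    using assms(2) unfolding powerful_voters_def by blast
  have "V - {x} \<in> S"
    using game_on_mono[OF assms(1) singleton_winning_swap[OF assms(1,2) *], of "V - {x}"] xy assms(3)
    by simp
  then show False
    using * xy assms(4) by (simp add: simple_game_def)
qed

lemma median_decomposition_of_two_powerful_voters:
  assumes "finite V" "game_on V S" "powerful_voters V S = {x, y}" "x \<noteq> y"
  shows "median_decomposition V S (copy_game V x y S) (copy_game V y x S)
    (if {x} \<in> S then Pow V else {})"
proof -
  have xy: "x \<in> V" "y \<in> V"
    using assms(3) unfolding powerful_voters_def by auto
  have "dummies V S \<subset> V"
    using xy assms(3) unfolding powerful_voters_def dummies_def by blast
  then have "card (dummies V S) < card V"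
    using assms(1) psubset_card_mono by blast
  then have "card (dummies V S) < card (dummies V (if {x} \<in> S then Pow V else {}))"
    unfolding dummies_constant .
  moreover have "card (dummies V S) < card (dummies V (copy_game V x y S))"
    "card (dummies V S) < card (dummies V (copy_game V y x S))"
    using card_dummies_copy_game[OF assms(1,2)] assms(3,4) by auto
  ultimately show ?thesis
    unfolding median_decomposition_def
    using median_game_copy_game_constant[OF assms] game_on_copy_game[OF assms(2)] xy
      game_on_constant[of V "{x} \<in> S"]
    by simp
qed

section \<open>Combining the two cases\<close>

text \<open>A single triple inherits each property that \<open>S\<close> has, so a strong and simple
  game needs no separate construction. Such a game never has exactly two powerful voters, since
  \<open>{x}\<close> would have to both win and lose.\<close>

lemma median_decomposition_exists:
  assumes "finite V" "game_on V S" "card (powerful_voters V S) \<ge> 2"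
  obtains S1 S2 S3 where "median_decomposition V S S1 S2 S3"
    "strong_game V S \<Longrightarrow> \<forall>T \<in> {S1, S2, S3}. strong_game V T"
    "simple_game V S \<Longrightarrow> \<forall>T \<in> {S1, S2, S3}. simple_game V T"
proof (cases "card (powerful_voters V S) = 2")
  case True
  then obtain x y where P: "powerful_voters V S = {x, y}" "x \<noteq> y"
    by (meson card_2_iff)
  then have xy: "x \<in> V" "y \<in> V"
    unfolding powerful_voters_def by auto
  show thesis
  proof (rule that[OF median_decomposition_of_two_powerful_voters[OF assms(1,2) P]])
    assume "strong_game V S"
    moreover from this have "{x} \<in> S"
      using strong_game_constant[OF assms(1,2) P] by blast
    then have "strong_game V (if {x} \<in> S then Pow V else {})"
      unfolding strong_game_def by simp
    ultimately show "\<forall>T \<in> {copy_game V x y S, copy_game V y x S, if {x} \<in> S then Pow V else {}}.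
        strong_game V T"
      using strong_copy_game[OF _ xy] strong_copy_game[OF _ xy(2,1)] by simp
  next
    assume "simple_game V S"
    moreover from this have "{x} \<notin> S"
      using simple_game_constant[OF assms(2) P] by blast
    then have "simple_game V (if {x} \<in> S then Pow V else {})"
      unfolding simple_game_def by simp
    ultimately show "\<forall>T \<in> {copy_game V x y S, copy_game V y x S, if {x} \<in> S then Pow V else {}}.
        simple_game V T"
      using simple_copy_game[OF _ xy] simple_copy_game[OF _ xy(2,1)] by simp
  qed
next
  case False
  then have "3 \<le> card (powerful_voters V S)"
    using assms(3) by simp
  then obtain Q where "Q \<subseteq> powerful_voters V S" "card Q = 3"
    by (meson obtain_subset_with_card_n)
  then obtain x y z where P: "{x, y, z} \<subseteq> powerful_voters V S" "x \<noteq> y" "y \<noteq> z" "z \<noteq> x"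
    by (metis card_3_iff)
  then have "x \<in> V" "y \<in> V" "z \<in> V"
    unfolding powerful_voters_def by auto
  then show thesis
    by (intro that[OF median_decomposition_of_three_powerful_voters[OF assms(1,2) P]])
      (simp_all add: strong_copy_game simple_copy_game)
qed

theorem theorem2:
  fixes V :: "'a set" and S :: "'a set set"
  assumes "finite V"
    and "game_on V S"
    and "card (powerful_voters V S) \<ge> 2"
  shows "(\<exists>S1 S2 S3. median_decomposition V S S1 S2 S3) \<and>
    (strong_game V S \<longrightarrow>
      (\<exists>S1 S2 S3. median_decomposition V S S1 S2 S3 \<and>
        (\<forall>T \<in> {S1, S2, S3}. strong_game V T))) \<and>
    (simple_game V S \<longrightarrow>
      (\<exists>S1 S2 S3. median_decomposition V S S1 S2 S3 \<and>
        (\<forall>T \<in> {S1, S2, S3}. simple_game V T))) \<and>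
    (strong_game V S \<and> simple_game V S \<longrightarrow>
      (\<exists>S1 S2 S3. median_decomposition V S S1 S2 S3 \<and>
        (\<forall>T \<in> {S1, S2, S3}. strong_game V T \<and> simple_game V T)))"
proof -
  obtain S1 S2 S3 where D: "median_decomposition V S S1 S2 S3"
    "strong_game V S \<Longrightarrow> \<forall>T \<in> {S1, S2, S3}. strong_game V T"
    "simple_game V S \<Longrightarrow> \<forall>T \<in> {S1, S2, S3}. simple_game V T"
    using median_decomposition_exists[OF assms] by blast
  show ?thesis
    by (intro conjI impI; (rule exI[of _ S1], rule exI[of _ S2], rule exI[of _ S3]); use D in blast)
qed

end
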